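(* Let $p \geq 4$ be an integer. Then: $$F(3,p;p+1) \leq \frac{13p}{4} \quad \text{if } p \equiv 0 \pmod 4;$$ $$F(3,p;p+1) \leq \frac{13p+23}{4} \quad \text{if } p \equiv 1 \pmod 4;$$ $$F(3,p;p+1) \leq \frac{13p+26}{4} \quad \text{if } p \equiv 2 \pmod 4;$$ $$F(3,p;p+1) \leq \frac{13p+29}{4} \quad \text{if } p \equiv 3 \pmod 4.$$
   Context: All graphs are finite, undirected, without loops or multiple edges. $V(G)$ denotes the vertex set of $G$. A $p$-clique of $G$ is a set of $p$ pairwise adjacent vertices, and $cl(G)$ is the largest $p$ such that $G$ contains a $p$-clique. For positive integers $a_1,\dots,a_r$, an $r$-coloring $V(G) = V_1 \cup \dots \cup V_r$ (with $V_i \cap V_j = \emptyset$ for $i \neq j$) is called $(a_1,\dots,a_r)$-free if, for each $i$, $V_i$ does not contain an $a_i$-clique. The notation $G \rightarrow (a_1,\dots,a_r)$ means that there is no $(a_1,\dots,a_r)$-free $r$-coloring of $V(G)$. For a positive integer $q$, the vertex Folkman number is $$F(a_1,\dots,a_r;q) = \min\{|V(G)| : G \rightarrow (a_1,\dots,a_r) \text{ and } cl(G) < q\}.$$ By a theorem of Folkman, such graphs $G$ exist (so the minimum is well defined) if and only if $q > \max\{a_1,\dots,a_r\}$. *)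

theory Defs
  imports Complex_Main "HOL-Library.Disjoint_Sets" "HOL-Library.Ramsey"
begin

definition simple_graph :: "'a set \<Rightarrow> 'a set set \<Rightarrow> bool" where
  "simple_graph V E \<longleftrightarrow> finite V \<and> E \<subseteq> [V]\<^bsup>2\<^esup>"

definition contains_clique :: "'a set set \<Rightarrow> 'a set \<Rightarrow> nat \<Rightarrow> bool" where
  "contains_clique E W p \<longleftrightarrow> (\<exists>K \<in> [W]\<^bsup>p\<^esup>. clique K E)"

definition clique_number :: "'a set \<Rightarrow> 'a set set \<Rightarrow> nat" where
  "clique_number V E = Max {p. contains_clique E V p}"

text \<open>The colour classes \<open>C i\<close> (\<open>i < length as\<close>) may be empty.\<close>

definition free_coloring :: "'a set \<Rightarrow> 'a set set \<Rightarrow> nat list \<Rightarrow> (nat \<Rightarrow> 'a set) \<Rightarrow> bool" where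
  "free_coloring V E as C \<longleftrightarrow>
     (\<Union>i<length as. C i) = V \<and> disjoint_family_on C {..<length as} \<and>
     (\<forall>i<length as. \<not> contains_clique E (C i) (as ! i))"

definition arrows :: "'a set \<Rightarrow> 'a set set \<Rightarrow> nat list \<Rightarrow> bool" where
  "arrows V E as \<longleftrightarrow> (\<nexists>C. free_coloring V E as C)"

text \<open>
  Every finite graph is isomorphic to one whose vertices are natural numbers, so it suffices
  to let the graphs range over \<^typ>\<open>nat\<close>. If no such graph exists then the value is an
  unspecified number, so an upper bound can only be established by exhibiting a graph.
\<close>

definition vertex_folkman :: "nat list \<Rightarrow> nat \<Rightarrow> nat" where
  "vertex_folkman as q =
     (LEAST n. \<exists>(V :: nat set) E. simple_graph V E \<and> card V = n \<and>
        arrows V E as \<and> clique_number V E < q)"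

end

(*
  Let G and H be graphs with clique numbers at most p and q that arrow (3,p) and (3,q). A
  triangle-free set of the join of G and H meets each side in a triangle-free set, so it misses a
  p-clique of G and a q-clique of H, which together form a (p+q)-clique. Hence
  F(3,p+q;p+q+1) is at most F(3,p;p+1) + F(3,q;q+1). By repeatedly joining a 13-vertex graph for
  p = 4, only one further graph per residue class modulo 4 is needed. Circulant graphs on 17, 13,
  22 and 18 vertices do for p = 3, 4, 5, 6.
*)

theory Submission
  imports Defs
begin

section \<open>Cliques and arrowing for two classes\<close>

lemma contains_cliqueI:
  assumes "K \<subseteq> W" "finite K" "k \<le> card K" "clique K E"
  shows "contains_clique E W k"
proof -
  obtain L where L: "L \<subseteq> K" "card L = k" "finite L"
    using assms(2,3) obtain_subset_with_card_n by metis
  then have "clique L E"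
    using assms(4) by (auto simp: clique_def)
  then show ?thesis
    using L assms(1) by (auto simp: contains_clique_def nsets_def)
qed

lemma contains_cliqueE:
  assumes "contains_clique E W k"
  obtains K where "K \<subseteq> W" "finite K" "card K = k" "clique K E"
  using assms by (auto simp: contains_clique_def nsets_def)

lemma contains_clique_mono:
  assumes "contains_clique E W k" "E \<subseteq> E'" "W \<subseteq> W'"
  shows "contains_clique E' W' k"
proof -
  obtain K where K: "K \<subseteq> W" "finite K" "card K = k" "clique K E"
    by (rule contains_cliqueE[OF assms(1)])
  moreover have "clique K E'"
    using K(4) assms(2) by (auto simp: clique_def)
  ultimately show ?thesis
    using assms(3) by (intro contains_cliqueI[of K]) auto
qed

text \<open>A colouring with two classes is determined by its first class, so one quantifier over
  \<open>T\<close> replaces colour functions, covering and disjointness.\<close>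

lemma arrows_pair_iff:
  "arrows V E [a, b] \<longleftrightarrow>
     (\<forall>T\<subseteq>V. contains_clique E T a \<or> contains_clique E (V - T) b)" (is "?L \<longleftrightarrow> ?R")
proof
  assume L: ?L
  show ?R
  proof (intro allI impI)
    fix T assume T: "T \<subseteq> V"
    let ?C = "\<lambda>i::nat. if i = 0 then T else V - T"
    have "\<not> free_coloring V E [a, b] ?C"
      using L by (auto simp: arrows_def)
    moreover have "(\<Union>i<length [a, b]. ?C i) = V"
      using T by (auto simp: lessThan_Suc)
    moreover have "disjoint_family_on ?C {..<length [a, b]}"
      by (auto simp: disjoint_family_on_def)
    ultimately obtain i where "i < length [a, b]" "contains_clique E (?C i) ([a, b] ! i)"
      unfolding free_coloring_def by blast
    then show "contains_clique E T a \<or> contains_clique E (V - T) b"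
      by (cases i) (simp_all split: if_splits)
  qed
next
  assume R: ?R
  show ?L
    unfolding arrows_def
  proof
    assume "\<exists>C. free_coloring V E [a, b] C"
    then obtain C where C: "free_coloring V E [a, b] C" by blast
    have U: "C 0 \<union> C 1 = V" and D: "C 0 \<inter> C 1 = {}"
      and F: "\<not> contains_clique E (C 0) a" "\<not> contains_clique E (C 1) b"
      using C by (auto simp: free_coloring_def disjoint_family_on_def lessThan_Suc Un_commute)
    have "C 1 = V - C 0" using U D by blast
    then show False using R F U by auto
  qed
qed

section \<open>Graphs that witness an upper bound\<close>

text \<open>The clique condition avoids \<open>clique_number\<close>, so that the constructions
  never have to handle \<open>Max\<close>; \<open>vertex_folkman_le\<close> makes the
  translation.\<close>

definition folkman_graph :: "'a set \<Rightarrow> 'a set set \<Rightarrow> nat \<Rightarrow> bool" where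
  "folkman_graph V E p \<longleftrightarrow>
     simple_graph V E \<and> arrows V E [3, p] \<and> \<not> contains_clique E V (p + 1)"

lemma vertex_folkman_le:
  fixes V :: "nat set"
  assumes "folkman_graph V E p"
  shows "vertex_folkman [3, p] (p + 1) \<le> card V"
proof -
  have g: "simple_graph V E" "arrows V E [3, p]" "\<not> contains_clique E V (p + 1)"
    using assms by (auto simp: folkman_graph_def)
  have fin: "finite V" using g(1) by (simp add: simple_graph_def)
  have bound: "k \<le> p" if k: "contains_clique E V k" for k
  proof (rule ccontr)
    assume "\<not> k \<le> p"
    moreover obtain K where "K \<subseteq> V" "finite K" "card K = k" "clique K E"
      by (rule contains_cliqueE[OF k])
    ultimately have "contains_clique E V (p + 1)"
      by (intro contains_cliqueI[of K]) auto
    then show False using g(3) by simp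
  qed
  \<comment> \<open>The empty clique keeps the set under \<open>Max\<close> nonempty and
    \<open>bound\<close> keeps it finite; otherwise \<open>Max\<close> would say nothing.\<close>
  have "contains_clique E V 0"
    by (rule contains_cliqueI[of "{}"]) (auto simp: clique_def)
  moreover have "finite {k. contains_clique E V k}"
    by (rule finite_subset[of _ "{..p}"]) (use bound in auto)
  ultimately have "clique_number V E \<le> p"
    unfolding clique_number_def using bound by (subst Max_le_iff) auto
  then show ?thesis
    unfolding vertex_folkman_def using g by (intro Least_le) fastforce
qed

section \<open>Relabelling along injections\<close>

lemma contains_clique_image:
  assumes "inj_on f V" "E \<subseteq> [V]\<^bsup>2\<^esup>" "W \<subseteq> V"
  shows "contains_clique ((`) f ` E) (f ` W) k \<longleftrightarrow> contains_clique E W k"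
proof -
  have edge: "{f v, f w} \<in> (`) f ` E \<longleftrightarrow> {v, w} \<in> E" if "v \<in> V" "w \<in> V" for v w
  proof
    assume "{f v, f w} \<in> (`) f ` E"
    then obtain e where e: "e \<in> E" "f ` {v, w} = f ` e" by auto
    \<comment> \<open>Edges lie inside \<open>V\<close>, where \<open>f\<close> is injective, so
      equal images force equal edges.\<close>
    then have "e \<subseteq> V" using assms(2) by (auto simp: nsets_def)
    then have "{v, w} = e"
      using inj_on_image_eq_iff[OF assms(1), of "{v, w}" e] e(2) that by blast
    then show "{v, w} \<in> E" using e(1) by simp
  qed (force intro: image_eqI[of _ _ "{v, w}"])
  have cl: "clique (f ` K) ((`) f ` E) \<longleftrightarrow> clique K E" if "K \<subseteq> V" for K
  proof -
    have "f v \<noteq> f w \<longleftrightarrow> v \<noteq> w" if "v \<in> K" "w \<in> K" for v w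
      using assms(1) \<open>K \<subseteq> V\<close> that by (auto dest: inj_onD)
    then show ?thesis
      using that edge unfolding clique_def by (simp add: subset_iff)
  qed
  show ?thesis
  proof
    assume "contains_clique ((`) f ` E) (f ` W) k"
    then obtain L where L: "L \<subseteq> f ` W" "finite L" "card L = k" "clique L ((`) f ` E)"
      by (rule contains_cliqueE)
    obtain K where K: "K \<subseteq> W" "L = f ` K" "inj_on f K"
      using L(1) by (metis subset_image_inj)
    then have "finite K" "card K = k"
      using L(2,3) by (auto simp: finite_image_iff card_image)
    then show "contains_clique E W k"
      using K L(4) cl assms(3) by (intro contains_cliqueI[of K]) auto
  next
    assume "contains_clique E W k"
    then obtain K where K: "K \<subseteq> W" "finite K" "card K = k" "clique K E"
      by (rule contains_cliqueE)
    then have "inj_on f K"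
      using assms(1,3) by (meson inj_on_subset subset_trans)
    then show "contains_clique ((`) f ` E) (f ` W) k"
      using K cl assms(3) by (intro contains_cliqueI[of "f ` K"]) (auto simp: card_image)
  qed
qed

text \<open>A colour class of the image is the image of a colour class. Relabelling serves to make
  vertex sets disjoint and to return to natural numbers.\<close>

lemma folkman_graph_image:
  assumes "folkman_graph V E p" "inj_on f V"
  shows "folkman_graph (f ` V) ((`) f ` E) p"
proof -
  have g: "finite V" "E \<subseteq> [V]\<^bsup>2\<^esup>" "arrows V E [3, p]" "\<not> contains_clique E V (p + 1)"
    using assms(1) by (auto simp: folkman_graph_def simple_graph_def)
  have "card (f ` e) = 2" if "e \<in> E" for e
    using that g(2) assms(2) by (metis (mono_tags, lifting) card_image inj_on_subset mem_Collect_eq nsets_def subset_iff)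
  then have "simple_graph (f ` V) ((`) f ` E)"
    using g(1,2) by (fastforce simp: simple_graph_def nsets_def)
  moreover have "arrows (f ` V) ((`) f ` E) [3, p]"
    unfolding arrows_pair_iff
  proof (intro allI impI)
    fix T assume "T \<subseteq> f ` V"
    then obtain S where S: "S \<subseteq> V" "T = f ` S" by (auto simp: subset_image_iff)
    have "f ` V - T = f ` (V - S)"
      using S assms(2) by (simp add: inj_on_image_set_diff)
    then show "contains_clique ((`) f ` E) T 3 \<or> contains_clique ((`) f ` E) (f ` V - T) p"
      using g(3) S contains_clique_image[OF assms(2) g(2)] by (auto simp: arrows_pair_iff)
  qed
  moreover have "\<not> contains_clique ((`) f ` E) (f ` V) (p + 1)"
    using g(4) contains_clique_image[OF assms(2) g(2)] by simp
  ultimately show ?thesis by (simp add: folkman_graph_def)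
qed

section \<open>Joins of graphs\<close>

definition graph_join :: "'a set \<Rightarrow> 'a set set \<Rightarrow> 'a set \<Rightarrow> 'a set set \<Rightarrow> 'a set set" where
  "graph_join V E W F = E \<union> F \<union> {{v, w} |v w. v \<in> V \<and> w \<in> W}"

text \<open>Makes \<open>clique_graph_join_left\<close> usable on the \<open>W\<close> side as
  well.\<close>

lemma graph_join_commute: "graph_join V E W F = graph_join W F V E"
proof -
  have "{{v, w} |v w. v \<in> V \<and> w \<in> W} = {{w, v} |w v. w \<in> W \<and> v \<in> V}"
    by (metis insert_commute)
  then show ?thesis by (auto simp: graph_join_def)
qed

text \<open>Edges of \<open>F\<close> lie in \<open>W\<close> and cross edges have an end in
  \<open>W\<close>, so a pair inside \<open>V\<close> can only come from \<open>E\<close>.\<close>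

lemma clique_graph_join_left:
  assumes "clique K (graph_join V E W F)" "V \<inter> W = {}" "F \<subseteq> [W]\<^bsup>2\<^esup>"
  shows "clique (K \<inter> V) E"
  unfolding clique_def
proof (intro ballI impI)
  fix u v assume uv: "u \<in> K \<inter> V" "v \<in> K \<inter> V" "u \<noteq> v"
  then have "{u, v} \<in> graph_join V E W F"
    using assms(1) by (auto simp: clique_def)
  then show "{u, v} \<in> E"
    using uv assms(2,3) by (auto simp: graph_join_def nsets_def doubleton_eq_iff)
qed

text \<open>Clique numbers add under joins: a clique of the join splits into a clique on each side,
  and cliques from the two sides always combine.\<close>

lemma folkman_graph_join:
  assumes "folkman_graph V E p" "folkman_graph W F q" "V \<inter> W = {}"
  shows "folkman_graph (V \<union> W) (graph_join V E W F) (p + q)"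
proof -
  let ?J = "graph_join V E W F"
  have g: "finite V" "E \<subseteq> [V]\<^bsup>2\<^esup>" "arrows V E [3, p]" "\<not> contains_clique E V (p + 1)"
    and h: "finite W" "F \<subseteq> [W]\<^bsup>2\<^esup>" "arrows W F [3, q]" "\<not> contains_clique F W (q + 1)"
    using assms(1,2) by (auto simp: folkman_graph_def simple_graph_def)
  have "?J \<subseteq> [V \<union> W]\<^bsup>2\<^esup>"
  proof -
    have "{{v, w} |v w. v \<in> V \<and> w \<in> W} \<subseteq> [V \<union> W]\<^bsup>2\<^esup>"
      using assms(3) by (auto simp: nsets_def card_insert_if)
    then show ?thesis
      using g(2) h(2) nsets_mono[of V "V \<union> W" 2] nsets_mono[of W "V \<union> W" 2]
      by (auto simp: graph_join_def)
  qed
  then have "simple_graph (V \<union> W) ?J"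
    using g(1) h(1) by (simp add: simple_graph_def)
  moreover have "arrows (V \<union> W) ?J [3, p + q]"
    unfolding arrows_pair_iff
  proof (intro allI impI)
    fix T assume T: "T \<subseteq> V \<union> W"
    have sub: "E \<subseteq> ?J" "F \<subseteq> ?J" by (auto simp: graph_join_def)
    show "contains_clique ?J T 3 \<or> contains_clique ?J (V \<union> W - T) (p + q)"
    proof (rule disjCI)
      assume *: "\<not> contains_clique ?J (V \<union> W - T) (p + q)"
      show "contains_clique ?J T 3"
      proof (rule ccontr)
        assume no: "\<not> contains_clique ?J T 3"
        then have "\<not> contains_clique E (T \<inter> V) 3" "\<not> contains_clique F (T \<inter> W) 3"
          using contains_clique_mono[OF _ sub(1)] contains_clique_mono[OF _ sub(2)] by blast+
        then have "contains_clique E (V - T \<inter> V) p" "contains_clique F (W - T \<inter> W) q"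
          using g(3) h(3) unfolding arrows_pair_iff by (meson inf_le2)+
        then obtain K L where K: "K \<subseteq> V - T" "finite K" "card K = p" "clique K E"
          and L: "L \<subseteq> W - T" "finite L" "card L = q" "clique L F"
          by (auto elim!: contains_cliqueE)
        have "clique (K \<union> L) ?J"
          unfolding clique_def
        proof (intro ballI impI)
          fix u v assume uv: "u \<in> K \<union> L" "v \<in> K \<union> L" "u \<noteq> v"
          then consider "u \<in> K" "v \<in> K" | "u \<in> L" "v \<in> L" | "u \<in> K" "v \<in> L" | "u \<in> L" "v \<in> K"
            by blast
          then show "{u, v} \<in> ?J"
          proof cases
            case 3
            then show ?thesis using K(1) L(1) by (auto simp: graph_join_def)
          next
            case 4
            \<comment> \<open>Cross edges are listed with the end in \<open>V\<close> first, hence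
              the swap.\<close>
            then show ?thesis
              using K(1) L(1) by (subst insert_commute) (auto simp: graph_join_def)
          qed (use uv K(4) L(4) in \<open>auto simp: graph_join_def clique_def\<close>)
        qed
        moreover have "card (K \<union> L) = p + q"
          using K L assms(3) by (subst card_Un_disjoint) auto
        ultimately have "contains_clique ?J (V \<union> W - T) (p + q)"
          using K L by (intro contains_cliqueI[of "K \<union> L"]) auto
        with * show False by simp
      qed
    qed
  qed
  moreover have "\<not> contains_clique ?J (V \<union> W) (p + q + 1)"
  proof
    assume "contains_clique ?J (V \<union> W) (p + q + 1)"
    then obtain K where K: "K \<subseteq> V \<union> W" "finite K" "card K = p + q + 1" "clique K ?J"
      by (rule contains_cliqueE)
    have "clique (K \<inter> V) E"
      using clique_graph_join_left[OF K(4) assms(3) h(2)] .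
    then have "card (K \<inter> V) \<le> p"
      using g(4) K(2) contains_cliqueI[of "K \<inter> V" V "p + 1" E] by fastforce
    moreover have "clique (K \<inter> W) F"
      using clique_graph_join_left[of K W F V E] K(4) assms(3) g(2)
      by (simp add: graph_join_commute Int_commute)
    then have "card (K \<inter> W) \<le> q"
      using h(4) K(2) contains_cliqueI[of "K \<inter> W" W "q + 1" F] by fastforce
    moreover have "card K = card (K \<inter> V) + card (K \<inter> W)"
      using K(1,2) assms(3) by (subst card_Un_disjoint[symmetric]) (auto intro: arg_cong[of _ _ card])
    ultimately show False using K(3) by linarith
  qed
  ultimately show ?thesis by (simp add: folkman_graph_def)
qed

section \<open>Attainable orders and their addition\<close>

text \<open>Records an attainable number of vertices, not the least one: attainable orders can be
  added, and each bounds the Folkman number from above.\<close>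

definition folkman_order :: "nat \<Rightarrow> nat \<Rightarrow> bool" where
  "folkman_order p n \<longleftrightarrow> (\<exists>(V :: nat set) E. folkman_graph V E p \<and> card V = n)"

lemma folkman_orderI:
  assumes "folkman_graph V E p"
  shows "folkman_order p (card V)"
proof -
  have "finite V" using assms by (simp add: folkman_graph_def simple_graph_def)
  then obtain f :: "'a \<Rightarrow> nat" where f: "inj_on f V"
    by (metis finite_imp_inj_to_nat_seg)
  show ?thesis
    unfolding folkman_order_def using folkman_graph_image[OF assms f] card_image[OF f] by blast
qed

lemma folkman_order_add:
  assumes "folkman_order p m" "folkman_order q n"
  shows "folkman_order (p + q) (m + n)"
proof -
  obtain V E W F where g: "folkman_graph (V :: nat set) E p" "card V = m"
    and h: "folkman_graph (W :: nat set) F q" "card W = n"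
    using assms by (auto simp: folkman_order_def)
  \<comment> \<open>\<open>V\<close> and \<open>W\<close> may overlap as sets of naturals, so the
    sum type supplies disjoint copies.\<close>
  let ?V = "Inl ` V :: (nat + nat) set" and ?W = "Inr ` W :: (nat + nat) set"
  have "folkman_graph (?V \<union> ?W)
      (graph_join ?V ((`) Inl ` E) ?W ((`) Inr ` F)) (p + q)"
    by (intro folkman_graph_join folkman_graph_image g h) auto
  moreover have "card (?V \<union> ?W) = m + n"
    using g h by (subst card_Un_disjoint)
      (auto simp: card_image folkman_graph_def simple_graph_def)
  ultimately show ?thesis by (metis folkman_orderI)
qed

lemma folkman_order_mult:
  assumes "folkman_order p n" "folkman_order q m"
  shows "folkman_order (k * p + q) (k * n + m)"
proof (induction k)
  case 0
  then show ?case using assms(2) by simp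
next
  case (Suc k)
  then show ?case
    using folkman_order_add[OF assms(1) Suc] by (simp add: add.assoc)
qed

section \<open>Clique search and the forcing test for triangle-free classes\<close>

text \<open>Returns the clique rather than a truth value, because \<open>forced\<close> branches
  over its vertices.\<close>

fun find_clique :: "('a \<Rightarrow> 'a \<Rightarrow> bool) \<Rightarrow> nat \<Rightarrow> 'a list \<Rightarrow> 'a list option" where
  "find_clique adj 0 xs = Some []"
| "find_clique adj (Suc k) [] = None"
| "find_clique adj (Suc k) (x # xs) =
     (case find_clique adj k (filter (adj x) xs) of
        None \<Rightarrow> find_clique adj (Suc k) xs
      | Some ys \<Rightarrow> Some (x # ys))"

definition adj_edges :: "('a \<Rightarrow> 'a \<Rightarrow> bool) \<Rightarrow> 'a set \<Rightarrow> 'a set set" where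
  "adj_edges adj V = {{u, v} |u v. u \<in> V \<and> v \<in> V \<and> u \<noteq> v \<and> adj u v}"

lemma adj_edges_iff:
  assumes "symp adj" "u \<in> V" "v \<in> V" "u \<noteq> v"
  shows "{u, v} \<in> adj_edges adj V \<longleftrightarrow> adj u v"
proof -
  have "adj u v \<longleftrightarrow> adj v u" using assms(1) by (metis sympD)
  then show ?thesis
    using assms(2-) by (auto simp: adj_edges_def doubleton_eq_iff)
qed

lemma clique_insert_adj_edges:
  assumes "symp adj" "insert x K \<subseteq> V" "x \<notin> K"
  shows "clique (insert x K) (adj_edges adj V) \<longleftrightarrow>
    clique K (adj_edges adj V) \<and> (\<forall>y\<in>K. adj x y)"
proof -
  have "{x, y} \<in> adj_edges adj V \<longleftrightarrow> adj x y" "{y, x} \<in> adj_edges adj V \<longleftrightarrow> adj x y"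
    if "y \<in> K" for y
    using adj_edges_iff[OF assms(1), of x V y] that assms(2,3) by (auto simp: insert_commute)
  then show ?thesis
    using assms(3) unfolding clique_def by auto
qed

text \<open>\<open>V\<close> is kept apart from \<open>set xs\<close> because the recursive calls
  shrink the list while the edge set must stay fixed.\<close>

lemma find_clique_Some:
  assumes "symp adj" "find_clique adj k xs = Some K" "set xs \<subseteq> V" "distinct xs"
  shows "set K \<subseteq> set xs \<and> distinct K \<and> length K = k \<and> clique (set K) (adj_edges adj V)"
  using assms
proof (induction adj k xs arbitrary: K rule: find_clique.induct)
  case (3 adj k x xs)
  show ?case
  proof (cases "find_clique adj k (filter (adj x) xs)")
    case None
    then show ?thesis using 3 by auto
  next
    case (Some ys)
    then have ys: "set ys \<subseteq> set (filter (adj x) xs)" "distinct ys" "length ys = k"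
      "clique (set ys) (adj_edges adj V)"
      using "3.IH"(1)[of ys] "3.prems" by auto
    then have "x \<notin> set ys" "insert x (set ys) \<subseteq> V" "\<forall>y\<in>set ys. adj x y"
      using "3.prems" by auto
    then show ?thesis
      using ys Some 3 clique_insert_adj_edges[of adj x "set ys" V] by auto
  qed
qed (auto simp: clique_def)

text \<open>A clique through \<open>x\<close> leaves a clique smaller by one among the neighbours of
  \<open>x\<close> in the tail, so failure of the first branch excludes \<open>x\<close> from
  \<open>K\<close>. The answer \<open>None\<close> thereby proves that no \<open>k\<close>-clique
  exists.\<close>

lemma find_clique_complete:
  assumes "symp adj" "distinct xs" "K \<subseteq> set xs" "\<And>u v. u \<in> K \<Longrightarrow> v \<in> K \<Longrightarrow> u \<noteq> v \<Longrightarrow> adj u v"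
    and "k \<le> card K"
  shows "find_clique adj k xs \<noteq> None"
  using assms
proof (induction adj k xs arbitrary: K rule: find_clique.induct)
  case (3 adj k x xs)
  note prems = "3.prems"
  have fin: "finite K" using prems(3) finite_subset by blast
  show ?case
  proof (cases "find_clique adj k (filter (adj x) xs)")
    case None
    have "x \<notin> K"
    proof
      assume "x \<in> K"
      then have "K - {x} \<subseteq> set (filter (adj x) xs)" "k \<le> card (K - {x})"
        using prems fin by auto
      then have "find_clique adj k (filter (adj x) xs) \<noteq> None"
        using prems by (intro "3.IH"(1)[of "K - {x}"]) auto
      then show False using None by simp
    qed
    then have "find_clique adj (Suc k) xs \<noteq> None"
      using prems by (intro "3.IH"(2)[OF None, of K]) auto
    then show ?thesis using None by simp
  qed simp
qed auto

text \<open>\<open>S\<close> lists vertices already known to lie in the triangle-free class. A \<open>p\<close>-clique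
  avoiding \<open>S\<close> must meet the class, so one may branch over its vertices; the first argument
  bounds the depth.\<close>

fun forced :: "nat \<Rightarrow> ('a \<Rightarrow> 'a \<Rightarrow> bool) \<Rightarrow> nat \<Rightarrow> 'a list \<Rightarrow> 'a list \<Rightarrow> bool" where
  "forced 0 adj p vs S = False"
| "forced (Suc d) adj p vs S =
     (case find_clique adj p (filter (\<lambda>v. v \<notin> set S) vs) of
        None \<Rightarrow> False
      | Some K \<Rightarrow> list_all (\<lambda>v. find_clique adj 2 (filter (adj v) S) \<noteq> None \<or>
          forced d adj p vs (v # S)) K)"

text \<open>Induction on the depth with invariant \<open>set S \<subseteq> T\<close>. The clique
  found outside \<open>S\<close> either misses \<open>T\<close> and is the one sought, or has a
  vertex in \<open>T\<close>, which can then be added to \<open>S\<close>.\<close>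

lemma forced_sound:
  assumes "symp adj" "distinct vs" "forced d adj p vs S" "distinct S" "set S \<subseteq> T" "T \<subseteq> set vs"
    and "\<not> contains_clique (adj_edges adj (set vs)) T 3"
  shows "contains_clique (adj_edges adj (set vs)) (set vs - T) p"
  using assms(3-5)
proof (induction d arbitrary: S)
  case (Suc d)
  let ?E = "adj_edges adj (set vs)"
  obtain K where K: "find_clique adj p (filter (\<lambda>v. v \<notin> set S) vs) = Some K"
    and *: "\<forall>v\<in>set K. find_clique adj 2 (filter (adj v) S) \<noteq> None \<or> forced d adj p vs (v # S)"
    using Suc.prems(1) by (auto split: option.splits simp: list_all_iff)
  have K': "set K \<subseteq> set (filter (\<lambda>v. v \<notin> set S) vs)" "distinct K" "length K = p" "clique (set K) ?E"
    using find_clique_Some[OF assms(1) K, of "set vs"] assms(2) by auto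
  show ?case
  proof (cases "set K \<inter> T = {}")
    case True
    then show ?thesis
      using K' by (intro contains_cliqueI[of "set K"]) (auto simp: distinct_card)
  next
    case False
    then obtain v where v: "v \<in> set K" "v \<in> T" by blast
    have vS: "v \<notin> set S" "v \<in> set vs" using v K'(1) by auto
    \<comment> \<open>An edge among the neighbours of \<open>v\<close> in \<open>S\<close> would
      close a triangle in \<open>T\<close>.\<close>
    have "find_clique adj 2 (filter (adj v) S) = None"
    proof (rule ccontr)
      assume "find_clique adj 2 (filter (adj v) S) \<noteq> None"
      then obtain L where "find_clique adj 2 (filter (adj v) S) = Some L" by blast
      then have L: "set L \<subseteq> set (filter (adj v) S)" "distinct L" "length L = 2" "clique (set L) ?E"
        using find_clique_Some[OF assms(1), of 2 "filter (adj v) S" L "set vs"] Suc.prems assms(6)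
        by auto
      then have "clique (insert v (set L)) ?E"
        using clique_insert_adj_edges[OF assms(1), of v "set L" "set vs"] vS Suc.prems assms(6)
        by auto
      moreover have "card (insert v (set L)) = 3"
        using L vS by (subst card_insert_disjoint) (auto simp: distinct_card)
      ultimately have "contains_clique ?E T 3"
        using L v Suc.prems by (intro contains_cliqueI[of "insert v (set L)"]) auto
      then show False using assms(7) by simp
    qed
    then have "forced d adj p vs (v # S)" using * v by blast
    then show ?thesis
      using v vS Suc.prems by (intro Suc.IH[of "v # S"]) auto
  qed
qed simp

text \<open>Reduces the graph conditions to two computations. Starting \<open>forced\<close> from
  the empty list covers every class \<open>T\<close> at once.\<close>

lemma folkman_graph_adj_edges:
  assumes "symp adj" "distinct vs" "forced d adj p vs []" "find_clique adj (Suc p) vs = None"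
  shows "folkman_graph (set vs) (adj_edges adj (set vs)) p"
proof -
  let ?E = "adj_edges adj (set vs)"
  have "simple_graph (set vs) ?E"
    by (auto simp: simple_graph_def adj_edges_def nsets_def)
  moreover have "arrows (set vs) ?E [3, p]"
    unfolding arrows_pair_iff using forced_sound[OF assms(1-3)] by auto
  moreover have "\<not> contains_clique ?E (set vs) (p + 1)"
  proof
    assume "contains_clique ?E (set vs) (p + 1)"
    then obtain K where K: "K \<subseteq> set vs" "card K = p + 1" "clique K ?E"
      by (rule contains_cliqueE)
    have "adj u v" if "u \<in> K" "v \<in> K" "u \<noteq> v" for u v
      using K that adj_edges_iff[OF assms(1), of u "set vs" v] by (auto simp: clique_def)
    then show False
      using find_clique_complete[OF assms(1,2) K(1), of "Suc p"] K(2) assms(4) by simp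
  qed
  ultimately show ?thesis by (simp add: folkman_graph_def)
qed

section \<open>Circulant graphs for p = 3, 4, 5, 6\<close>

text \<open>No reduction modulo \<open>n\<close> is made: with \<open>n - d\<close> listed beside
  \<open>d\<close>, the absolute difference already describes a circulant graph. Integers keep the
  subtraction from being truncated.\<close>

definition dist_adj :: "int list \<Rightarrow> int \<Rightarrow> int \<Rightarrow> bool" where
  "dist_adj D x y \<longleftrightarrow> \<bar>x - y\<bar> \<in> set D"

lemma folkman_order_dist_adj:
  assumes "forced d (dist_adj D) p [0..int n - 1] []"
    and "find_clique (dist_adj D) (Suc p) [0..int n - 1] = None"
  shows "folkman_order p n"
proof -
  have "symp (dist_adj D)"
    by (auto simp: symp_def dist_adj_def abs_minus_commute)
  then show ?thesis
    using folkman_orderI[OF folkman_graph_adj_edges[of "dist_adj D" "[0..int n - 1]" d p]] assms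
    by simp
qed

text \<open>The distance sets were found by computer search over circulant graphs. Each contains, with
  \<open>d\<close>, also \<open>n - d\<close>.\<close>

lemma folkman_order_3: "folkman_order 3 17"
proof (rule folkman_order_dist_adj)
  \<comment> \<open>These are the nonzero squares modulo 17, so the graph is the Paley graph of
    order 17.\<close>
  let ?D = "[1, 2, 4, 8, 9, 13, 15, 16]"
  \<comment> \<open>The depth 9 is only fuel: too small a value would make the evaluation return
    \<open>False\<close>, never a wrong \<open>True\<close>.\<close>
  have "forced 9 (dist_adj ?D) 3 [0..16] []"
    by code_simp
  then show "forced 9 (dist_adj ?D) 3 [0..int 17 - 1] []"
    by simp
  have "find_clique (dist_adj ?D) 4 [0..16] = None"
    by code_simp
  then show "find_clique (dist_adj ?D) (Suc 3) [0..int 17 - 1] = None"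
    by simp
qed

lemma folkman_order_4: "folkman_order 4 13"
proof (rule folkman_order_dist_adj)
  \<comment> \<open>The complement has distances 4, 6, 7, 9, which is 4 times the set 1, 5, 8, 12 of
    cubic residues modulo 13. It is the Ramsey graph on 13 vertices without a triangle or five
    independent vertices.\<close>
  let ?D = "[1, 2, 3, 5, 8, 10, 11, 12]"
  have "forced 9 (dist_adj ?D) 4 [0..12] []"
    by code_simp
  then show "forced 9 (dist_adj ?D) 4 [0..int 13 - 1] []"
    by simp
  have "find_clique (dist_adj ?D) 5 [0..12] = None"
    by code_simp
  then show "find_clique (dist_adj ?D) (Suc 4) [0..int 13 - 1] = None"
    by simp
qed

lemma folkman_order_5: "folkman_order 5 22"
proof (rule folkman_order_dist_adj)
  let ?D = "[1, 2, 3, 4, 6, 9, 10, 12, 13, 16, 18, 19, 20, 21]"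
  have "forced 9 (dist_adj ?D) 5 [0..21] []"
    by code_simp
  then show "forced 9 (dist_adj ?D) 5 [0..int 22 - 1] []"
    by simp
  have "find_clique (dist_adj ?D) 6 [0..21] = None"
    by code_simp
  then show "find_clique (dist_adj ?D) (Suc 5) [0..int 22 - 1] = None"
    by simp
qed

lemma folkman_order_6: "folkman_order 6 18"
proof (rule folkman_order_dist_adj)
  let ?D = "[1, 4, 5, 6, 7, 8, 9, 10, 11, 12, 13, 14, 17]"
  have "forced 9 (dist_adj ?D) 6 [0..17] []"
    by code_simp
  then show "forced 9 (dist_adj ?D) 6 [0..int 18 - 1] []"
    by simp
  have "find_clique (dist_adj ?D) 7 [0..17] = None"
    by code_simp
  then show "find_clique (dist_adj ?D) (Suc 6) [0..int 18 - 1] = None"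
    by simp
qed

section \<open>The bounds by residue class modulo 4\<close>

lemma vertex_folkman_le_order:
  assumes "folkman_order p n"
  shows "vertex_folkman [3, p] (p + 1) \<le> n"
  using assms vertex_folkman_le by (auto simp: folkman_order_def)

theorem corollary1:
  fixes p :: nat
  assumes "p \<ge> 4"
  shows "(p mod 4 = 0 \<longrightarrow> real (vertex_folkman [3, p] (p + 1)) \<le> 13 * real p / 4) \<and>
         (p mod 4 = 1 \<longrightarrow> real (vertex_folkman [3, p] (p + 1)) \<le> (13 * real p + 23) / 4) \<and>
         (p mod 4 = 2 \<longrightarrow> real (vertex_folkman [3, p] (p + 1)) \<le> (13 * real p + 26) / 4) \<and>
         (p mod 4 = 3 \<longrightarrow> real (vertex_folkman [3, p] (p + 1)) \<le> (13 * real p + 29) / 4)"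
proof -
  \<comment> \<open>One block of 4 is held back so that the last graph has parameter
    \<open>4 + p mod 4\<close>; the subtraction is exact since \<open>p \<ge> 4\<close>.\<close>
  define j where "j = p div 4 - 1"
  have p: "p = j * 4 + (4 + p mod 4)"
    using assms by (simp add: j_def algebra_simps)
  have bound: "real (vertex_folkman [3, p] (p + 1)) \<le> 13 * real i + real n"
    if "folkman_order q n" "p = i * 4 + q" for i q n
    using vertex_folkman_le_order[OF folkman_order_mult[OF folkman_order_4 that(1), of i]] that(2)
    by simp
  show ?thesis
  proof (intro conjI impI)
    assume "p mod 4 = 0"
    then have "p = j * 4 + 4" using p by simp
    from bound[OF folkman_order_4 this] arg_cong[OF this, of real]
    show "real (vertex_folkman [3, p] (p + 1)) \<le> 13 * real p / 4" by simp
  next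
    assume "p mod 4 = 1"
    then have "p = j * 4 + 5" using p by simp
    from bound[OF folkman_order_5 this] arg_cong[OF this, of real]
    show "real (vertex_folkman [3, p] (p + 1)) \<le> (13 * real p + 23) / 4" by simp
  next
    assume "p mod 4 = 2"
    then have "p = j * 4 + 6" using p by simp
    \<comment> \<open>This case has slack: at \<open>p = 6\<close> the formula allows 26 vertices,
      while the graph has 18.\<close>
    from bound[OF folkman_order_6 this] arg_cong[OF this, of real]
    show "real (vertex_folkman [3, p] (p + 1)) \<le> (13 * real p + 26) / 4" by simp
  next
    assume "p mod 4 = 3"
    \<comment> \<open>The remainder 7 is split as 4 + 3, since the graph at hand is the one for 3;
      this uses one more 13-vertex block.\<close>
    then have "p = (j + 1) * 4 + 3" using p by simp
    from bound[OF folkman_order_3 this] arg_cong[OF this, of real]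
    show "real (vertex_folkman [3, p] (p + 1)) \<le> (13 * real p + 29) / 4" by simp
  qed
qed

end
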